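(* Suppose that the undirected graph $\mathcal G$ is connected. A matrix $X^*\in\mathbb R^{r\times p}$ is a least squares solution to the equation $AXB=F$ if and only if there exist $Y^*\in\mathbb R^{r\times q}$, $Z^*\in\mathbb R^{nr\times q}$, $U^*\in\mathbb R^{nm\times q}$ and $W^*\in\mathbb R^{nm\times q}$ such that $(X^*,Y^*,Z^*,U^*,W^* )$ is a solution to the optimization problem $$\begin{aligned}\min_{X,Y,U,W,Z}\ &\sum_{i=1}^n\|A_{li}Y_{vi}-[F_{vi}]_{\rm R}-U_i\|_{\rm F}^2\\ \text{s.t.}\ &[Y_{vi}]_{\rm R}-X_{li}B_{vi}-\sum_{j=1}^n a_{i,j}(Z_i-Z_j)=0_{r\times q},\\ &U_i=\sum_{j=1}^n a_{i,j}(W_i-W_j),\quad i\in\{1,\ldots,n\}.\end{aligned}$$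
   Context: $A\in\mathbb R^{m\times r}$, $B\in\mathbb R^{p\times q}$, $F\in\mathbb R^{m\times q}$ are partitioned (Column-Row-Row structure) as $A=[A_{l1},\ldots,A_{ln}]$, $B=[B_{v1}^{\rm T},\ldots,B_{vn}^{\rm T}]^{\rm T}$, $F=[F_{v1}^{\rm T},\ldots,F_{vn}^{\rm T}]^{\rm T}$ with $A_{li}\in\mathbb R^{m\times r_i}$, $B_{vi}\in\mathbb R^{p_i\times q}$, $F_{vi}\in\mathbb R^{m_i\times q}$, $\sum_i r_i=r$, $\sum_i p_i=p$, $\sum_i m_i=m$. The variables are $X=[X_{l1},\ldots,X_{ln}]\in\mathbb R^{r\times p}$ with $X_{li}\in\mathbb R^{r\times p_i}$; $Y=[Y_{v1}^{\rm T},\ldots,Y_{vn}^{\rm T}]^{\rm T}\in\mathbb R^{r\times q}$ with $Y_{vi}\in\mathbb R^{r_i\times q}$; $U=[U_1^{\rm T},\ldots,U_n^{\rm T}]^{\rm T}$ and $W=[W_1^{\rm T},\ldots,W_n^{\rm T}]^{\rm T}$ in $\mathbb R^{nm\times q}$ with $U_i,W_i\in\mathbb R^{m\times q}$; $Z=[Z_1^{\rm T},\ldots,Z_n^{\rm T}]^{\rm T}\in\mathbb R^{nr\times q}$ with $Z_i\in\mathbb R^{r\times q}$. Augmented matrices: $[Y_{vi}]_{\rm R}\in\mathbb R^{r\times q}$ has $i$th row-block (partition $r_1,\ldots,r_n$) equal to $Y_{vi}$ and zeros elsewhere; $[F_{vi}]_{\rm R}\in\mathbb R^{m\times q}$ has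 $i$th row-block (partition $m_1,\ldots,m_n$) equal to $F_{vi}$ and zeros elsewhere. $\mathcal G$ is an undirected graph on $\{1,\ldots,n\}$ with symmetric adjacency matrix $[a_{i,j}]$, $a_{i,j}=a_{j,i}>0$ if $\{j,i\}$ is an edge and $a_{i,j}=0$ otherwise. A least squares solution to $AXB=F$ is a minimizer of $\|AXB-F\|_{\rm F}^2$ over $X\in\mathbb R^{r\times p}$. *)

theory Defs
  imports "Jordan_Normal_Form.Matrix" "Graph_Theory.Graph_Theory"
begin

text \<open>
  Blocks are numbered from 1, while the entries of a matrix of type \<^typ>\<open>real mat\<close> are
  indexed from 0. A partition into blocks is given by the function \<open>d\<close> of block sizes; the
  uniform partition of an \<open>(n * k)\<close>-row matrix has \<open>d = (\<lambda>_. k)\<close>.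
\<close>

definition block_offset :: "(nat \<Rightarrow> nat) \<Rightarrow> nat \<Rightarrow> nat" where
  "block_offset d i = (\<Sum>j = 1..<i. d j)"

definition row_block :: "(nat \<Rightarrow> nat) \<Rightarrow> nat \<Rightarrow> real mat \<Rightarrow> real mat" where
  "row_block d i M =
     mat (d i) (dim_col M) (\<lambda>(s, t). M $$ (block_offset d i + s, t))"

definition col_block :: "(nat \<Rightarrow> nat) \<Rightarrow> nat \<Rightarrow> real mat \<Rightarrow> real mat" where
  "col_block d i M =
     mat (dim_row M) (d i) (\<lambda>(s, t). M $$ (s, block_offset d i + t))"

text \<open>
  The augmented matrix \<open>[N]\<^sub>R\<close>: the matrix with \<open>n\<close> row blocks of sizes \<open>d 1, \<dots>, d n\<close>
  whose \<open>i\<close>th row block is \<open>N\<close> and whose other entries vanish.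
\<close>

definition row_augment :: "(nat \<Rightarrow> nat) \<Rightarrow> nat \<Rightarrow> nat \<Rightarrow> real mat \<Rightarrow> real mat" where
  "row_augment d n i N =
     mat (\<Sum>j = 1..n. d j) (dim_col N)
       (\<lambda>(s, t). if block_offset d i \<le> s \<and> s < block_offset d i + d i
                 then N $$ (s - block_offset d i, t) else 0)"

definition frob_norm :: "real mat \<Rightarrow> real" where
  "frob_norm M = sqrt (sum_mat (map_mat (\<lambda>x. x\<^sup>2) M))"

text \<open>
  Finite sums of matrices, in analogy to \<^const>\<open>finsum_vec\<close>. The dimensions are parameters
  because type \<^typ>\<open>real mat\<close> has no zero shared by all dimensions.
\<close>

definition finsum_mat :: "nat \<Rightarrow> nat \<Rightarrow> ('c \<Rightarrow> real mat) \<Rightarrow> 'c set \<Rightarrow> real mat" where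
  "finsum_mat nr nc = finprod (monoid_mat TYPE(real) nr nc)"

lemma index_finsum_mat:
  assumes "finite S" and "s < nr" and "t < nc" and "f \<in> S \<rightarrow> carrier_mat nr nc"
  shows "finsum_mat nr nc f S \<in> carrier_mat nr nc \<and>
         finsum_mat nr nc f S $$ (s, t) = (\<Sum>x\<in>S. f x $$ (s, t))"
proof -
  interpret M: comm_monoid "monoid_mat TYPE(real) nr nc"
    by (rule comm_monoid_mat)
  show ?thesis
    using assms(1,4)
  proof (induction S rule: finite_induct)
    case empty
    have "finsum_mat nr nc f {} = 0\<^sub>m nr nc"
      unfolding finsum_mat_def M.finprod_empty by (simp add: monoid_mat_def)
    then show ?case
      using assms(2,3) by simp
  next
    case (insert x S)
    then have f: "f \<in> S \<rightarrow> carrier (monoid_mat TYPE(real) nr nc)"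
      "f x \<in> carrier (monoid_mat TYPE(real) nr nc)"
      by (auto simp: monoid_mat_def)
    have "finsum_mat nr nc f (insert x S) = f x + finsum_mat nr nc f S"
      using M.finprod_insert[OF insert.hyps f] by (simp add: finsum_mat_def monoid_mat_def)
    with insert assms(2,3) show ?case
      by auto
  qed
qed

text \<open>The sum \<open>\<Sum>\<^sub>j a\<^sub>i\<^sub>j (V\<^sub>i - V\<^sub>j)\<close>, where \<open>V\<close> stacks \<open>n\<close> blocks of dimension \<open>k \<times> q\<close>.\<close>

definition laplacian_block ::
  "nat \<Rightarrow> (nat \<Rightarrow> nat \<Rightarrow> real) \<Rightarrow> nat \<Rightarrow> nat \<Rightarrow> real mat \<Rightarrow> nat \<Rightarrow> real mat" where
  "laplacian_block n a k q V i =
     finsum_mat k q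
       (\<lambda>j. a i j \<cdot>\<^sub>m (row_block (\<lambda>_. k) i V - row_block (\<lambda>_. k) j V)) {1..n}"

definition weighted_adjacency ::
  "nat pair_pre_digraph \<Rightarrow> (nat \<Rightarrow> nat \<Rightarrow> real) \<Rightarrow> bool" where
  "weighted_adjacency G a \<longleftrightarrow>
     (\<forall>i \<in> pverts G. \<forall>j \<in> pverts G.
        a i j = a j i \<and> (if (j, i) \<in> parcs G then a i j > 0 else a i j = 0))"

definition least_squares_solution ::
  "real mat \<Rightarrow> real mat \<Rightarrow> real mat \<Rightarrow> real mat \<Rightarrow> bool" where
  "least_squares_solution A B F X \<longleftrightarrow>
     is_arg_min (\<lambda>X. (frob_norm (A * X * B - F))\<^sup>2)
       (\<lambda>X. X \<in> carrier_mat (dim_col A) (dim_row B)) X"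

definition crr_objective ::
  "nat \<Rightarrow> (nat \<Rightarrow> nat) \<Rightarrow> (nat \<Rightarrow> nat) \<Rightarrow> real mat \<Rightarrow> real mat \<Rightarrow>
   real mat \<times> real mat \<times> real mat \<times> real mat \<times> real mat \<Rightarrow> real" where
  "crr_objective n ms rs A F = (\<lambda>(X, Y, Z, U, W).
     \<Sum>i = 1..n. (frob_norm
       (col_block rs i A * row_block rs i Y
        - row_augment ms n i (row_block ms i F)
        - row_block (\<lambda>_. \<Sum>j = 1..n. ms j) i U))\<^sup>2)"

definition crr_feasible ::
  "nat \<Rightarrow> (nat \<Rightarrow> nat \<Rightarrow> real) \<Rightarrow> (nat \<Rightarrow> nat) \<Rightarrow> (nat \<Rightarrow> nat) \<Rightarrow> (nat \<Rightarrow> nat) \<Rightarrow> nat \<Rightarrow>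
   real mat \<Rightarrow> real mat \<times> real mat \<times> real mat \<times> real mat \<times> real mat \<Rightarrow> bool" where
  "crr_feasible n a ms rs ps q B = (\<lambda>(X, Y, Z, U, W).
     let m = (\<Sum>i = 1..n. ms i); r = (\<Sum>i = 1..n. rs i); p = (\<Sum>i = 1..n. ps i) in
       X \<in> carrier_mat r p \<and> Y \<in> carrier_mat r q \<and> Z \<in> carrier_mat (n * r) q \<and>
       U \<in> carrier_mat (n * m) q \<and> W \<in> carrier_mat (n * m) q \<and>
       (\<forall>i \<in> {1..n}.
          row_augment rs n i (row_block rs i Y) - col_block ps i X * row_block ps i B
            - laplacian_block n a r q Z i = 0\<^sub>m r q \<and>
          row_block (\<lambda>_. m) i U = laplacian_block n a m q W i))"

end

theory Submission
  imports Defs "Jordan_Normal_Form.Determinant"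
begin

text \<open>
  Summing the first constraint over \<open>i\<close> removes the Laplacian term and leaves \<open>Y = X B\<close>; summing the
  second one gives \<open>\<Sum>\<^sub>i U\<^sub>i = 0\<close>. Hence the \<open>n\<close> residuals of a feasible point add up to \<open>A X B - F\<close>, and
  its objective value is at least \<open>\<parallel>A X B - F\<parallel>\<^sup>2 / n\<close>, with equality if all residuals agree. Conversely,
  for each \<open>X\<close> this bound is attained: put \<open>Y = X B\<close>, let \<open>U\<close> make all residuals equal, and find \<open>Z\<close>
  and \<open>W\<close> from the fact that the Laplacian of a connected graph maps onto the families with sum
  zero. So minimizing over the remaining variables leaves a multiple of the least squares objective.
\<close>

section \<open>Block partitions\<close>

lemma block_offset_Suc: "block_offset d (Suc n) = (\<Sum>j = 1..n. d j)"
  by (simp add: block_offset_def atLeastLessThanSuc_atLeastAtMost)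

lemma block_offset_const: "block_offset (\<lambda>_. k) i = (i - 1) * k"
  by (simp add: block_offset_def)

lemma block_offset_less:
  assumes "i \<in> {1..n}" and "s < d i"
  shows "block_offset d i + s < (\<Sum>j = 1..n. d j)"
proof -
  have "block_offset d i + s < (\<Sum>j = 1..<Suc i. d j)"
    using assms by (simp add: block_offset_def)
  also have "\<dots> \<le> (\<Sum>j = 1..n. d j)"
    using assms(1) by (intro sum_mono2) auto
  finally show ?thesis .
qed

lemma block_offset_less_const:
  fixes i k s :: nat
  assumes "i \<in> {1..n}" and "s < k"
  shows "(i - 1) * k + s < n * k"
  using block_offset_less[of i n s "\<lambda>_. k"] assms by (simp add: block_offset_const)

text \<open>Each row or column index is an offset plus a local index. In the induction the last
  block is the tail of the range, shifted down to start at 0.\<close>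

lemma sum_blocks:
  fixes f :: "nat \<Rightarrow> 'a :: comm_monoid_add"
  shows "(\<Sum>u = 0..<(\<Sum>j = 1..n. d j). f u) = (\<Sum>i = 1..n. \<Sum>s = 0..<d i. f (block_offset d i + s))"
proof (induction n)
  case (Suc n)
  let ?S = "\<Sum>j = 1..n. d j"
  have "(\<Sum>u = 0..<?S + d (Suc n). f u) = (\<Sum>u = 0..<?S. f u) + (\<Sum>u = ?S..<?S + d (Suc n). f u)"
    by (simp add: sum.atLeastLessThan_concat)
  also have "(\<Sum>u = ?S..<?S + d (Suc n). f u) = (\<Sum>s = 0..<d (Suc n). f (?S + s))"
    using sum.shift_bounds_nat_ivl[of f 0 ?S "d (Suc n)"] by (simp add: add.commute)
  finally show ?case
    using Suc by (simp add: block_offset_Suc)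
qed simp

text \<open>The blocks partition the index range, so exactly one indicator fires. The induction
  peels off the last block: \<open>s\<close> lies either before its offset, or past the end of all
  earlier blocks.\<close>

lemma sum_block_indicator:
  fixes x :: "'a :: comm_monoid_add"
  assumes "s < (\<Sum>j = 1..n. d j)"
  shows "(\<Sum>i = 1..n. if block_offset d i \<le> s \<and> s < block_offset d i + d i then x else 0) = x"
  using assms
proof (induction n)
  case (Suc n)
  show ?case
  proof (cases "s < (\<Sum>j = 1..n. d j)")
    case True
    then show ?thesis using Suc by (simp add: block_offset_Suc)
  next
    case False
    have "block_offset d i + d i \<le> s" if "i \<in> {1..n}" for i
    proof -
      have "block_offset d i + d i \<le> (\<Sum>j = 1..n. d j)"
      \<comment> \<open>An empty block has no last index to which \<open>block_offset_less\<close>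
        could be applied.\<close>
      proof (cases "d i")
        case 0
        then show ?thesis
          using that unfolding block_offset_def by (auto intro!: sum_mono2)
      next
        case (Suc e)
        then show ?thesis using block_offset_less[OF that, of e d] by simp
      qed
      then show ?thesis using False by simp
    qed
    then have "(\<Sum>i = 1..n. if block_offset d i \<le> s \<and> s < block_offset d i + d i then x else 0) = 0"
      by (intro sum.neutral ballI) (metis leD)
    then show ?thesis using False Suc.prems by (simp add: block_offset_Suc)
  qed
qed simp

lemma sum_row_augment_row_block:
  assumes "s < (\<Sum>j = 1..n. d j)" and "t < dim_col M"
  shows "(\<Sum>i = 1..n. row_augment d n i (row_block d i M) $$ (s, t)) = M $$ (s, t)"
proof -
  have "row_augment d n i (row_block d i M) $$ (s, t) =
      (if block_offset d i \<le> s \<and> s < block_offset d i + d i then M $$ (s, t) else 0)" for i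
    using assms by (auto simp: row_augment_def row_block_def)
  then show ?thesis
    using sum_block_indicator[OF assms(1)] by simp
qed

text \<open>Block multiplication: the inner summation index of \<open>C * D\<close> is split along
  the partition.\<close>

lemma sum_col_block_mult_row_block:
  assumes "C \<in> carrier_mat l (\<Sum>j = 1..n. d j)" and "D \<in> carrier_mat (\<Sum>j = 1..n. d j) q"
    and "s < l" and "t < q"
  shows "(\<Sum>i = 1..n. (col_block d i C * row_block d i D) $$ (s, t)) = (C * D) $$ (s, t)"
proof -
  have "(col_block d i C * row_block d i D) $$ (s, t) =
      (\<Sum>u = 0..<d i. C $$ (s, block_offset d i + u) * D $$ (block_offset d i + u, t))" for i
    using assms by (simp add: col_block_def row_block_def scalar_prod_def)
  moreover have "(C * D) $$ (s, t) = (\<Sum>u = 0..<(\<Sum>j = 1..n. d j). C $$ (s, u) * D $$ (u, t))"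
    using assms by (simp add: scalar_prod_def)
  ultimately show ?thesis
    by (simp only: sum_blocks)
qed

lemma col_block_mult_row_block_carrier:
  assumes "C \<in> carrier_mat l x" and "D \<in> carrier_mat y q"
  shows "col_block d i C * row_block d i D \<in> carrier_mat l q"
  using assms by (auto simp: col_block_def row_block_def)

lemma row_augment_carrier:
  assumes "M \<in> carrier_mat x q"
  shows "row_augment d n i (row_block d i M) \<in> carrier_mat (\<Sum>j = 1..n. d j) q"
  using assms by (auto simp: row_augment_def row_block_def)

lemma ex_row_blocks:
  assumes "\<And>i. i \<in> {1..n} \<Longrightarrow> b i \<in> carrier_mat k q"
  shows "\<exists>V \<in> carrier_mat (n * k) q. \<forall>i \<in> {1..n}. row_block (\<lambda>_. k) i V = b i"
proof
  \<comment> \<open>Row \<open>u\<close> belongs to the block numbered \<open>u div k + 1\<close>,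
    because blocks are counted from 1 and rows from 0.\<close>
  let ?V = "mat (n * k) q (\<lambda>(u, t). b (u div k + 1) $$ (u mod k, t))"
  show "?V \<in> carrier_mat (n * k) q" by simp
  show "\<forall>i \<in> {1..n}. row_block (\<lambda>_. k) i ?V = b i"
  proof
    fix i assume i: "i \<in> {1..n}"
    show "row_block (\<lambda>_. k) i ?V = b i"
    proof (rule eq_matI)
      fix s t assume "s < dim_row (b i)" "t < dim_col (b i)"
      then have st: "s < k" "t < q" using assms[OF i] by auto
      have "((i - 1) * k + s) div k + 1 = i" "((i - 1) * k + s) mod k = s"
        using st(1) i by auto
      then show "row_block (\<lambda>_. k) i ?V $$ (s, t) = b i $$ (s, t)"
        using st block_offset_less_const[OF i st(1)] by (simp add: row_block_def block_offset_const)
    qed (use assms[OF i] in \<open>auto simp: row_block_def\<close>)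
  qed
qed

section \<open>The Laplacian of a connected graph\<close>

lemma laplacian_block_carrier:
  assumes "dim_col V = q"
  shows "laplacian_block n a k q V i \<in> carrier_mat k q"
proof -
  interpret M: comm_monoid "monoid_mat TYPE(real) k q"
    by (rule comm_monoid_mat)
  have "finprod (monoid_mat TYPE(real) k q)
      (\<lambda>j. a i j \<cdot>\<^sub>m (row_block (\<lambda>_. k) i V - row_block (\<lambda>_. k) j V)) {1..n}
      \<in> carrier (monoid_mat TYPE(real) k q)"
    using assms by (intro M.finprod_closed) (auto simp: monoid_mat_def row_block_def)
  then show ?thesis
    by (simp add: laplacian_block_def finsum_mat_def monoid_mat_def)
qed

lemma laplacian_block_index:
  assumes "dim_col V = q" and "s < k" and "t < q"
  shows "laplacian_block n a k q V i $$ (s, t) =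
    (\<Sum>j = 1..n. a i j * (row_block (\<lambda>_. k) i V $$ (s, t) - row_block (\<lambda>_. k) j V $$ (s, t)))"
proof -
  let ?f = "\<lambda>j. a i j \<cdot>\<^sub>m (row_block (\<lambda>_. k) i V - row_block (\<lambda>_. k) j V)"
  have "?f \<in> {1..n} \<rightarrow> carrier_mat k q"
    using assms(1) by (auto simp: row_block_def)
  from index_finsum_mat[OF _ assms(2,3) this]
  have "laplacian_block n a k q V i $$ (s, t) = (\<Sum>j = 1..n. ?f j $$ (s, t))"
    by (simp add: laplacian_block_def)
  also have "\<dots> = (\<Sum>j = 1..n. a i j *
      (row_block (\<lambda>_. k) i V $$ (s, t) - row_block (\<lambda>_. k) j V $$ (s, t)))"
    using assms by (intro sum.cong) (auto simp: row_block_def)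
  finally show ?thesis .
qed

text \<open>Connectedness enters only as the statement that a potential constant along edges is constant.\<close>

locale connected_weights =
  fixes n :: nat and a :: "nat \<Rightarrow> nat \<Rightarrow> real"
  assumes nonempty: "n > 0"
    and weight_sym: "\<lbrakk>i \<in> {1..n}; j \<in> {1..n}\<rbrakk> \<Longrightarrow> a i j = a j i"
    and weight_nonneg: "\<lbrakk>i \<in> {1..n}; j \<in> {1..n}\<rbrakk> \<Longrightarrow> a i j \<ge> 0"
    and potential_const:
      "\<And>z :: nat \<Rightarrow> real. \<lbrakk>\<And>i j. \<lbrakk>i \<in> {1..n}; j \<in> {1..n}; a i j > 0\<rbrakk> \<Longrightarrow> z i = z j;
        i \<in> {1..n}; j \<in> {1..n}\<rbrakk> \<Longrightarrow> z i = z j"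
begin

text \<open>By symmetry of the weights the summand is antisymmetric in \<open>i\<close> and
  \<open>j\<close>, so exchanging the two sums gives cancellation.\<close>

lemma sum_laplacian: "(\<Sum>i = 1..n. \<Sum>j = 1..n. a i j * (z i - z j)) = 0"
proof -
  have "(\<Sum>i = 1..n. \<Sum>j = 1..n. a i j * z j) = (\<Sum>j = 1..n. \<Sum>i = 1..n. a i j * z j)"
    by (rule sum.swap)
  also have "\<dots> = (\<Sum>i = 1..n. \<Sum>j = 1..n. a i j * z i)"
    by (intro sum.cong) (auto simp: weight_sym)
  finally show ?thesis
    by (simp add: right_diff_distrib sum_subtractf)
qed

text \<open>The Dirichlet energy of a kernel element vanishes. Its terms are nonnegative, so
  \<open>z\<close> agrees across every edge of positive weight, and connectedness does the
  rest.\<close>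

lemma laplacian_kernel:
  assumes ker: "\<And>i. i \<in> {1..n} \<Longrightarrow> (\<Sum>j = 1..n. a i j * (z i - z j)) = 0"
    and "i \<in> {1..n}" and "j \<in> {1..n}"
  shows "z i = z j"
proof (rule potential_const[OF _ assms(2,3)])
  \<comment> \<open>This is (x - y)^2 = 2 x (x - y) - (x^2 - y^2), weighted and summed. The last
    part is a total Laplacian sum of the squares, hence zero.\<close>
  have "(\<Sum>i = 1..n. \<Sum>j = 1..n. a i j * (z i - z j)\<^sup>2) =
      2 * (\<Sum>i = 1..n. z i * (\<Sum>j = 1..n. a i j * (z i - z j)))
      - (\<Sum>i = 1..n. \<Sum>j = 1..n. a i j * ((z i)\<^sup>2 - (z j)\<^sup>2))"
    unfolding sum_distrib_left sum_subtractf[symmetric]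
    by (intro sum.cong) (auto simp: power2_eq_square algebra_simps)
  also have "\<dots> = 0"
    using sum_laplacian[of "\<lambda>i. (z i)\<^sup>2"] ker by simp
  finally have 0: "(\<Sum>i = 1..n. \<Sum>j = 1..n. a i j * (z i - z j)\<^sup>2) = 0" .
  fix k l assume kl: "k \<in> {1..n}" "l \<in> {1..n}" "a k l > 0"
  have "(\<Sum>j = 1..n. a k j * (z k - z j)\<^sup>2) = 0"
    using 0 kl(1) by (subst (asm) sum_nonneg_eq_0_iff) (auto intro!: sum_nonneg mult_nonneg_nonneg weight_nonneg)
  then have "a k l * (z k - z l)\<^sup>2 = 0"
    using kl(1,2) by (subst (asm) sum_nonneg_eq_0_iff) (auto intro!: mult_nonneg_nonneg weight_nonneg)
  then show "z k = z l"
    using kl(3) by simp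
qed

text \<open>
  Adding the all-ones matrix to the Laplacian makes it injective, hence invertible, and changes
  nothing on families with sum zero.
\<close>

lemma laplacian_surj:
  assumes "(\<Sum>i = 1..n. b i) = 0"
  shows "\<exists>z. \<forall>i \<in> {1..n}. (\<Sum>j = 1..n. a i j * (z i - z j)) = b i"
proof -
  \<comment> \<open>Matrix indices start at 0 and vertices at 1, hence the \<open>Suc\<close>. A
    loop weight enters the row sum and is subtracted again on the diagonal.\<close>
  define M where "M = mat n n (\<lambda>(i, j).
    (if i = j then \<Sum>l = 1..n. a (Suc i) l else 0) - a (Suc i) (Suc j) + 1)"
  have M: "M \<in> carrier_mat n n" by (simp add: M_def)
  have shift: "(\<Sum>j = 0..<n. f (Suc j)) = (\<Sum>j = 1..n. f j)" for f :: "nat \<Rightarrow> real"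
    using sum.shift_bounds_Suc_ivl[of f 0 n] by (simp add: atLeastLessThanSuc_atLeastAtMost)
  have Mv: "(M *\<^sub>v v) $ (i - 1) =
      (\<Sum>j = 1..n. a i j * (v $ (i - 1) - v $ (j - 1))) + (\<Sum>j = 1..n. v $ (j - 1))"
    if v: "v \<in> carrier_vec n" and i: "i \<in> {1..n}" for v i
  proof -
    have "(M *\<^sub>v v) $ (i - 1) = (\<Sum>j = 0..<n. M $$ (i - 1, j) * v $ j)"
    proof -
      have "i - 1 < n" using i by auto
      then show ?thesis using v M by (simp add: scalar_prod_def)
    qed
    also have "\<dots> = (\<Sum>j = 0..<n. (if i - 1 = j then (\<Sum>l = 1..n. a i l) * v $ (i - 1) else 0)
        - a i (Suc j) * v $ j + v $ j)"
      using i by (intro sum.cong) (auto simp: M_def algebra_simps)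
    also have "\<dots> = (\<Sum>l = 1..n. a i l) * v $ (i - 1) - (\<Sum>j = 0..<n. a i (Suc j) * v $ j)
        + (\<Sum>j = 0..<n. v $ j)"
      using i by (auto simp: sum.distrib sum_subtractf)
    also have "\<dots> = (\<Sum>j = 1..n. a i j * (v $ (i - 1) - v $ (j - 1))) + (\<Sum>j = 1..n. v $ (j - 1))"
      using shift[of "\<lambda>j. a i j * v $ (j - 1)"] shift[of "\<lambda>j. v $ (j - 1)"]
      by (simp add: right_diff_distrib sum_subtractf sum_distrib_right)
    finally show ?thesis .
  qed
  \<comment> \<open>Summing the rows kills the Laplacian part; only the all-ones part
    survives.\<close>
  have sum_Mv: "(\<Sum>i = 1..n. (M *\<^sub>v v) $ (i - 1)) = n * (\<Sum>j = 1..n. v $ (j - 1))"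
    if v: "v \<in> carrier_vec n" for v
  proof -
    have "(\<Sum>i = 1..n. (M *\<^sub>v v) $ (i - 1)) = (\<Sum>i = 1..n.
        (\<Sum>j = 1..n. a i j * (v $ (i - 1) - v $ (j - 1))) + (\<Sum>j = 1..n. v $ (j - 1)))"
      using Mv[OF v] by (intro sum.cong) auto
    then show ?thesis
      using sum_laplacian[of "\<lambda>i. v $ (i - 1)"] by (simp add: sum.distrib)
  qed
  \<comment> \<open>If \<open>M\<close> annihilates \<open>v\<close>, then \<open>v\<close> has sum
    zero, so it lies in the Laplacian kernel and is constant; a constant vector with sum zero
    vanishes.\<close>
  have "v = 0\<^sub>v n" if v: "v \<in> carrier_vec n" and Mv0: "M *\<^sub>v v = 0\<^sub>v n" for v
  proof -
    have sum0: "(\<Sum>j = 1..n. v $ (j - 1)) = 0"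
    proof -
      have "(\<Sum>i = 1..n. (M *\<^sub>v v) $ (i - 1)) = 0"
        by (intro sum.neutral) (auto simp: Mv0)
      then show ?thesis using sum_Mv[OF v] nonempty by simp
    qed
    have const: "v $ (i - 1) = v $ (j - 1)" if "i \<in> {1..n}" "j \<in> {1..n}" for i j
      using laplacian_kernel[of "\<lambda>i. v $ (i - 1)", OF _ that] Mv[OF v] Mv0 sum0 by force
    have "v $ i = 0" if i: "i < n" for i
    proof -
      have "(\<Sum>j = 1..n. v $ (j - 1)) = (\<Sum>j = 1..n. v $ i)"
        using i const[of _ "Suc i"] by (intro sum.cong) auto
      then show ?thesis using sum0 nonempty by simp
    qed
    then show ?thesis using v by auto
  qed
  then have "det M \<noteq> 0"
    using det_0_iff_vec_prod_zero[OF M] by auto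
  then obtain N where N: "N \<in> carrier_mat n n" "M * N = 1\<^sub>m n"
    using det_non_zero_imp_unit[OF M] by (auto simp: Units_def ring_mat_def)
  define v where "v = N *\<^sub>v vec n (\<lambda>i. b (Suc i))"
  have v: "v \<in> carrier_vec n" using N by (simp add: v_def)
  have "M *\<^sub>v v = vec n (\<lambda>i. b (Suc i))"
    using N M by (simp add: v_def assoc_mult_mat_vec[symmetric])
  then have b: "(M *\<^sub>v v) $ (i - 1) = b i" if "i \<in> {1..n}" for i
    using that by auto
  \<comment> \<open>Since \<open>b\<close> has sum zero, so has \<open>v\<close>. The all-ones part
    then contributes nothing, and \<open>v\<close> solves the Laplacian system itself.\<close>
  have "n * (\<Sum>j = 1..n. v $ (j - 1)) = 0"
    using sum_Mv[OF v] b assms by simp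
  then have "(\<Sum>j = 1..n. v $ (j - 1)) = 0"
    using nonempty by simp
  then show ?thesis
    using Mv[OF v] b by (intro exI[of _ "\<lambda>i. v $ (i - 1)"]) auto
qed

section \<open>Transfer of the scalar results to matrix blocks\<close>

lemma sum_laplacian_block:
  assumes "dim_col V = q" and "s < k" and "t < q"
  shows "(\<Sum>i = 1..n. laplacian_block n a k q V i $$ (s, t)) = 0"
  using assms sum_laplacian[of "\<lambda>i. row_block (\<lambda>_. k) i V $$ (s, t)"]
  by (simp add: laplacian_block_index)

text \<open>The block Laplacian acts on each entry position separately, so one scalar potential is
  chosen per position and the results are stacked.\<close>

lemma laplacian_block_surj:
  assumes b: "\<And>i. i \<in> {1..n} \<Longrightarrow> b i \<in> carrier_mat k q"
    and sum0: "\<And>s t. \<lbrakk>s < k; t < q\<rbrakk> \<Longrightarrow> (\<Sum>i = 1..n. b i $$ (s, t)) = 0"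
  shows "\<exists>V \<in> carrier_mat (n * k) q. \<forall>i \<in> {1..n}. laplacian_block n a k q V i = b i"
proof -
  have "\<exists>z. \<forall>i \<in> {1..n}. (\<Sum>j = 1..n. a i j * (z i - z j)) = b i $$ (s, t)"
    if "s < k" "t < q" for s t
    using laplacian_surj sum0[OF that] .
  then obtain z where z: "(\<Sum>j = 1..n. a i j * (z s t i - z s t j)) = b i $$ (s, t)"
    if "s < k" "t < q" "i \<in> {1..n}" for s t i
    by metis
  obtain V where V: "V \<in> carrier_mat (n * k) q"
    and blocks: "\<And>i. i \<in> {1..n} \<Longrightarrow> row_block (\<lambda>_. k) i V = mat k q (\<lambda>(s, t). z s t i)"
    using ex_row_blocks[of n "\<lambda>i. mat k q (\<lambda>(s, t). z s t i)" k q] by auto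
  have "laplacian_block n a k q V i = b i" if i: "i \<in> {1..n}" for i
  proof (rule eq_matI)
    fix s t assume "s < dim_row (b i)" "t < dim_col (b i)"
    then have st: "s < k" "t < q" using b[OF i] by auto
    then have "laplacian_block n a k q V i $$ (s, t) = (\<Sum>j = 1..n. a i j * (z s t i - z s t j))"
      using V i by (auto simp: laplacian_block_index blocks intro!: sum.cong)
    then show "laplacian_block n a k q V i $$ (s, t) = b i $$ (s, t)"
      using z[OF st i] by simp
  qed (use laplacian_block_carrier[of V q n a k i] V b[OF i] in auto)
  then show ?thesis using V by blast
qed

end

text \<open>Connectedness means that the symmetrized digraph is strongly connected. A potential
  constant along arcs is carried along a walk by induction.\<close>

lemma connected_weightsI:
  assumes "pair_pseudo_graph G" and verts: "pverts G = {1..n}"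
    and weights: "weighted_adjacency G a" and conn: "Digraph_Component.connected (with_proj G)"
  shows "connected_weights n a"
proof
  have sconn: "strongly_connected (with_proj (mk_symmetric (with_proj G)))"
    using conn by (simp add: connected_def)
  \<comment> \<open>Strong connectedness includes that the vertex set is nonempty.\<close>
  then show "n > 0" by (auto simp: strongly_connected_def verts)
  show sym: "a i j = a j i" and "a i j \<ge> 0" if "i \<in> {1..n}" "j \<in> {1..n}" for i j
    using weights that unfolding weighted_adjacency_def verts by (metis less_eq_real_def)+
  fix z :: "nat \<Rightarrow> real" and i j
  assume edge: "\<And>i j. \<lbrakk>i \<in> {1..n}; j \<in> {1..n}; a i j > 0\<rbrakk> \<Longrightarrow> z i = z j"
    and ij: "i \<in> {1..n}" "j \<in> {1..n}"
  interpret G: pair_pseudo_graph G by fact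
  have arc: "z u = z v" if "(u, v) \<in> parcs G" for u v
  proof -
    have "u \<in> {1..n}" "v \<in> {1..n}"
      using that G.arc_fst_in_verts G.arc_snd_in_verts by (auto simp: verts)
    \<comment> \<open>\<open>weighted_adjacency\<close> ties the weight \<open>a i j\<close> to the
      arc from \<open>j\<close> to \<open>i\<close>, so the indices are reversed here.\<close>
    moreover from this have "a v u > 0"
      using weights that unfolding weighted_adjacency_def verts by metis
    ultimately show ?thesis using edge by metis
  qed
  have "i \<rightarrow>\<^sup>*\<^bsub>with_proj (mk_symmetric (with_proj G))\<^esub> j"
    using sconn ij by (auto simp: strongly_connected_def verts)
  then have "(i, j) \<in> (parcs (mk_symmetric (with_proj G)))\<^sup>*"
    using reachable_rtranclI by fastforce
  then show "z i = z j"
    by (induction rule: rtrancl_induct) (auto simp: parcs_mk_symmetric dest: arc)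
qed

section \<open>Minimizing over the auxiliary variables\<close>

lemma frob_norm_sq:
  assumes "M \<in> carrier_mat k q"
  shows "(frob_norm M)\<^sup>2 = (\<Sum>s = 0..<k. \<Sum>t = 0..<q. (M $$ (s, t))\<^sup>2)"
proof -
  have "sum_mat (map_mat (\<lambda>x. x\<^sup>2) M) = (\<Sum>s = 0..<k. \<Sum>t = 0..<q. (M $$ (s, t))\<^sup>2)"
    using assms by (auto simp: sum_mat_def sum.cartesian_product intro!: sum.cong)
  then show ?thesis
    by (simp add: frob_norm_def sum_nonneg)
qed

text \<open>Cauchy-Schwarz against the all-ones vector, obtained by expanding the squared deviations
  from the mean \<open>S / n\<close>. For \<open>n = 0\<close> both sides are 0, as division by zero
  yields 0.\<close>

lemma square_sum_le:
  fixes e :: "nat \<Rightarrow> real"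
  shows "(\<Sum>i = 1..n. e i)\<^sup>2 / n \<le> (\<Sum>i = 1..n. (e i)\<^sup>2)"
proof (cases "n = 0")
  case False
  define S where "S = (\<Sum>i = 1..n. e i)"
  have "0 \<le> (\<Sum>i = 1..n. (e i - S / n)\<^sup>2)"
    by (intro sum_nonneg) auto
  also have "\<dots> = (\<Sum>i = 1..n. (e i)\<^sup>2 - 2 * (S / n) * e i + (S / n)\<^sup>2)"
    by (intro sum.cong) (auto simp: power2_diff)
  also have "\<dots> = (\<Sum>i = 1..n. (e i)\<^sup>2) - 2 * (S / n) * S + n * (S / n)\<^sup>2"
    unfolding sum.distrib sum_subtractf sum_distrib_left[symmetric] S_def[symmetric] by simp
  also have "\<dots> = (\<Sum>i = 1..n. (e i)\<^sup>2) - S\<^sup>2 / n"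
    using False by (simp add: field_simps power2_eq_square)
  finally show ?thesis by (simp add: S_def)
qed simp

lemma frob_norm_sum_le:
  fixes R :: "nat \<Rightarrow> real mat"
  assumes "\<And>i. i \<in> {1..n} \<Longrightarrow> R i \<in> carrier_mat k q" and M: "M \<in> carrier_mat k q"
    and sum: "\<And>s t. \<lbrakk>s < k; t < q\<rbrakk> \<Longrightarrow> (\<Sum>i = 1..n. R i $$ (s, t)) = M $$ (s, t)"
  shows "(frob_norm M)\<^sup>2 / n \<le> (\<Sum>i = 1..n. (frob_norm (R i))\<^sup>2)"
proof -
  have "(frob_norm M)\<^sup>2 / n = (\<Sum>s = 0..<k. \<Sum>t = 0..<q. (\<Sum>i = 1..n. R i $$ (s, t))\<^sup>2 / n)"
    unfolding frob_norm_sq[OF M] sum_divide_distrib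
    by (intro sum.cong refl) (simp only: sum atLeastLessThan_iff)
  also have "\<dots> \<le> (\<Sum>s = 0..<k. \<Sum>t = 0..<q. \<Sum>i = 1..n. (R i $$ (s, t))\<^sup>2)"
    by (intro sum_mono square_sum_le)
  also have "\<dots> = (\<Sum>s = 0..<k. \<Sum>i = 1..n. \<Sum>t = 0..<q. (R i $$ (s, t))\<^sup>2)"
    by (intro sum.cong refl sum.swap)
  also have "\<dots> = (\<Sum>i = 1..n. \<Sum>s = 0..<k. \<Sum>t = 0..<q. (R i $$ (s, t))\<^sup>2)"
    by (rule sum.swap)
  also have "\<dots> = (\<Sum>i = 1..n. (frob_norm (R i))\<^sup>2)"
    by (intro sum.cong refl frob_norm_sq[symmetric] assms(1))
  finally show ?thesis .
qed

section \<open>The constrained problem and its reduction to least squares\<close>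

locale crr_problem = connected_weights +
  fixes m r p q :: nat and ms rs ps :: "nat \<Rightarrow> nat" and A B F :: "real mat"
  assumes m_def: "m = (\<Sum>i = 1..n. ms i)" and r_def: "r = (\<Sum>i = 1..n. rs i)"
    and p_def: "p = (\<Sum>i = 1..n. ps i)"
    and A: "A \<in> carrier_mat m r" and B: "B \<in> carrier_mat p q" and F: "F \<in> carrier_mat m q"
begin

abbreviation objective where "objective \<equiv> crr_objective n ms rs A F"
abbreviation feasible where "feasible \<equiv> crr_feasible n a ms rs ps q B"

text \<open>The residual of agent \<open>i\<close> before the correction \<open>U_i\<close> is
  subtracted; it depends on \<open>Y\<close> alone among the variables.\<close>

definition local_residual :: "real mat \<Rightarrow> nat \<Rightarrow> real mat" where
  "local_residual Y i = col_block rs i A * row_block rs i Y - row_augment ms n i (row_block ms i F)"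

lemma objective_eq: "objective (X, Y, Z, U, W) =
    (\<Sum>i = 1..n. (frob_norm (local_residual Y i - row_block (\<lambda>_. m) i U))\<^sup>2)"
  by (simp add: crr_objective_def local_residual_def m_def)

lemma feasible_iff: "feasible (X, Y, Z, U, W) \<longleftrightarrow>
    X \<in> carrier_mat r p \<and> Y \<in> carrier_mat r q \<and> Z \<in> carrier_mat (n * r) q \<and>
    U \<in> carrier_mat (n * m) q \<and> W \<in> carrier_mat (n * m) q \<and>
    (\<forall>i \<in> {1..n}.
      row_augment rs n i (row_block rs i Y) - col_block ps i X * row_block ps i B
        - laplacian_block n a r q Z i = 0\<^sub>m r q \<and>
      row_block (\<lambda>_. m) i U = laplacian_block n a m q W i)"
  by (simp add: crr_feasible_def m_def r_def p_def Let_def)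

lemma local_residual_carrier: "local_residual Y i \<in> carrier_mat m q"
  unfolding local_residual_def using row_augment_carrier[OF F, of ms n i] by (auto simp: m_def)

text \<open>The block products assemble \<open>A * Y\<close>, and the augmented blocks assemble
  \<open>F\<close>.\<close>

lemma sum_local_residual:
  assumes Y: "Y \<in> carrier_mat r q" and "s < m" and "t < q"
  shows "(\<Sum>i = 1..n. local_residual Y i $$ (s, t)) = (A * Y - F) $$ (s, t)"
proof -
  have "local_residual Y i $$ (s, t) = (col_block rs i A * row_block rs i Y) $$ (s, t)
      - row_augment ms n i (row_block ms i F) $$ (s, t)" for i
    using row_augment_carrier[OF F, of ms n i] assms(2,3)
    by (auto simp: local_residual_def m_def)
  then show ?thesis
    using assms A F
      sum_row_augment_row_block[of s ms n t F] sum_col_block_mult_row_block[of A m rs n Y q s t]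
    by (simp add: sum_subtractf m_def r_def)
qed

text \<open>In the sum of the first constraint over \<open>i\<close> the augmented blocks reassemble
  \<open>Y\<close>, the block products reassemble \<open>X * B\<close>, and the Laplacian terms
  cancel.\<close>

lemma feasible_eq_mult:
  assumes feas: "feasible (X, Y, Z, U, W)"
  shows "Y = X * B"
proof (rule eq_matI)
  have X: "X \<in> carrier_mat r p" and Y: "Y \<in> carrier_mat r q" and Z: "Z \<in> carrier_mat (n * r) q"
    using feas by (auto simp: feasible_iff)
  show dims: "dim_row Y = dim_row (X * B)" "dim_col Y = dim_col (X * B)"
    using X Y B by auto
  fix s t assume "s < dim_row (X * B)" "t < dim_col (X * B)"
  then have st: "s < r" "t < q" using X B by auto
  have "row_augment rs n i (row_block rs i Y) $$ (s, t) =
      (col_block ps i X * row_block ps i B) $$ (s, t) + laplacian_block n a r q Z i $$ (s, t)"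
    if i: "i \<in> {1..n}" for i
  proof -
    have "row_augment rs n i (row_block rs i Y) - col_block ps i X * row_block ps i B
        - laplacian_block n a r q Z i = 0\<^sub>m r q"
      using feas i by (auto simp: feasible_iff)
    from arg_cong[OF this, of "\<lambda>M. M $$ (s, t)"] show ?thesis
      using st carrier_matD[OF laplacian_block_carrier[of Z q n a r i]] Z
        carrier_matD[OF col_block_mult_row_block_carrier[OF X B, of ps i]]
        carrier_matD[OF row_augment_carrier[OF Y, of rs n i]]
      by (simp add: r_def)
  qed
  then have "(\<Sum>i = 1..n. row_augment rs n i (row_block rs i Y) $$ (s, t)) =
      (\<Sum>i = 1..n. (col_block ps i X * row_block ps i B) $$ (s, t))
      + (\<Sum>i = 1..n. laplacian_block n a r q Z i $$ (s, t))"
    by (simp add: sum.distrib)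
  then show "Y $$ (s, t) = (X * B) $$ (s, t)"
    using st X Y Z B sum_row_augment_row_block[of s rs n t Y]
      sum_col_block_mult_row_block[of X r ps n B q s t] sum_laplacian_block[of Z q s r t]
    by (simp add: r_def p_def)
qed

text \<open>The corrections \<open>U_i\<close> are Laplacian blocks and sum to zero, so
  \<open>frob_norm_sum_le\<close> applies to residuals with total
  \<open>A * X * B - F\<close>.\<close>

lemma feasible_objective_ge:
  assumes feas: "feasible (X, Y, Z, U, W)"
  shows "(frob_norm (A * X * B - F))\<^sup>2 / n \<le> objective (X, Y, Z, U, W)"
  unfolding objective_eq
proof (rule frob_norm_sum_le)
  have X: "X \<in> carrier_mat r p" and Y: "Y \<in> carrier_mat r q" and W: "W \<in> carrier_mat (n * m) q"
    and U: "\<And>i. i \<in> {1..n} \<Longrightarrow> row_block (\<lambda>_. m) i U = laplacian_block n a m q W i"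
    using feas by (auto simp: feasible_iff)
  have Ui: "row_block (\<lambda>_. m) i U \<in> carrier_mat m q" if "i \<in> {1..n}" for i
    using U[OF that] laplacian_block_carrier[of W q n a m i] W by auto
  show "local_residual Y i - row_block (\<lambda>_. m) i U \<in> carrier_mat m q" if "i \<in> {1..n}" for i
    using Ui[OF that] by auto
  \<comment> \<open>A matrix difference takes its dimensions from the second operand.\<close>
  show "A * X * B - F \<in> carrier_mat m q" using F by auto
  fix s t assume st: "s < m" "t < q"
  have "(\<Sum>i = 1..n. (local_residual Y i - row_block (\<lambda>_. m) i U) $$ (s, t)) =
      (\<Sum>i = 1..n. local_residual Y i $$ (s, t) - laplacian_block n a m q W i $$ (s, t))"
    using st U carrier_matD[OF laplacian_block_carrier[of W q]] W by (intro sum.cong) auto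
  also have "\<dots> = (A * Y - F) $$ (s, t)"
    using sum_local_residual[OF Y st] sum_laplacian_block[of W q s m t] st W
    by (simp add: sum_subtractf)
  also have "A * Y = A * X * B"
    using A X B by (simp add: feasible_eq_mult[OF feas])
  finally show "(\<Sum>i = 1..n. (local_residual Y i - row_block (\<lambda>_. m) i U) $$ (s, t)) =
      (A * X * B - F) $$ (s, t)" .
qed

text \<open>This is the equality case of Cauchy-Schwarz: the total residual is distributed evenly
  over the agents.\<close>

lemma ex_feasible_objective_eq:
  assumes X: "X \<in> carrier_mat r p"
  shows "\<exists>Y Z U W. feasible (X, Y, Z, U, W) \<and>
    objective (X, Y, Z, U, W) = (frob_norm (A * X * B - F))\<^sup>2 / n"
proof -
  define Y where "Y = X * B"
  \<comment> \<open>The only possible common residual: \<open>n\<close> copies must add up to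
    \<open>A * X * B - F\<close>.\<close>
  define E where "E = (1 / n) \<cdot>\<^sub>m (A * X * B - F)"
  have Y: "Y \<in> carrier_mat r q" and E: "E \<in> carrier_mat m q"
    using X B F by (auto simp: Y_def E_def)
  have AY: "A * Y = A * X * B" using A X B by (simp add: Y_def)
  let ?b = "\<lambda>i. row_augment rs n i (row_block rs i Y) - col_block ps i X * row_block ps i B"
  have aug: "row_augment rs n i (row_block rs i Y) \<in> carrier_mat r q" for i
    using row_augment_carrier[OF Y] by (simp add: r_def)
  note mult = col_block_mult_row_block_carrier[OF X B]
  have b: "?b i \<in> carrier_mat r q" for i
    by (rule minus_carrier_mat[OF mult])
  \<comment> \<open>Solvable because the right-hand sides add up to \<open>Y - X * B\<close>, which
    is zero.\<close>
  have "\<exists>Z \<in> carrier_mat (n * r) q. \<forall>i \<in> {1..n}. laplacian_block n a r q Z i = ?b i"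
  proof (rule laplacian_block_surj)
    fix s t assume st: "s < r" "t < q"
    have "(\<Sum>i = 1..n. ?b i $$ (s, t)) = (\<Sum>i = 1..n.
        row_augment rs n i (row_block rs i Y) $$ (s, t) - (col_block ps i X * row_block ps i B) $$ (s, t))"
      using st carrier_matD[OF mult] by (intro sum.cong) auto
    also have "\<dots> = 0"
      using st X Y B sum_row_augment_row_block[of s rs n t Y]
        sum_col_block_mult_row_block[of X r ps n B q s t]
      by (simp add: sum_subtractf r_def p_def) (simp add: Y_def)
    finally show "(\<Sum>i = 1..n. ?b i $$ (s, t)) = 0" .
  qed (rule b)
  then obtain Z where Z: "Z \<in> carrier_mat (n * r) q"
    "\<And>i. i \<in> {1..n} \<Longrightarrow> laplacian_block n a r q Z i = ?b i" by blast
  have "\<exists>U \<in> carrier_mat (n * m) q. \<forall>i \<in> {1..n}. row_block (\<lambda>_. m) i U = local_residual Y i - E"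
    using E by (intro ex_row_blocks) auto
  then obtain U where U: "U \<in> carrier_mat (n * m) q"
    "\<And>i. i \<in> {1..n} \<Longrightarrow> row_block (\<lambda>_. m) i U = local_residual Y i - E" by blast
  \<comment> \<open>Solvable because the local residuals add up to \<open>n\<close> times
    \<open>E\<close>.\<close>
  have "\<exists>W \<in> carrier_mat (n * m) q. \<forall>i \<in> {1..n}. laplacian_block n a m q W i = local_residual Y i - E"
  proof (rule laplacian_block_surj)
    fix s t assume st: "s < m" "t < q"
    have "(\<Sum>i = 1..n. (local_residual Y i - E) $$ (s, t)) =
        (\<Sum>i = 1..n. local_residual Y i $$ (s, t) - E $$ (s, t))"
      using st E by (intro sum.cong) auto
    also have "\<dots> = (A * Y - F) $$ (s, t) - n * E $$ (s, t)"
      using sum_local_residual[OF Y st] by (simp add: sum_subtractf)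
    also have "\<dots> = 0"
      using st F A Y B nonempty by (simp add: E_def AY)
    finally show "(\<Sum>i = 1..n. (local_residual Y i - E) $$ (s, t)) = 0" .
  qed (use E in auto)
  then obtain W where W: "W \<in> carrier_mat (n * m) q"
    "\<And>i. i \<in> {1..n} \<Longrightarrow> laplacian_block n a m q W i = local_residual Y i - E" by blast
  have "feasible (X, Y, Z, U, W)"
    unfolding feasible_iff using X Y Z U W minus_r_inv_mat[OF b] by auto
  moreover have "objective (X, Y, Z, U, W) = (frob_norm (A * X * B - F))\<^sup>2 / n"
  proof -
    have "local_residual Y i - row_block (\<lambda>_. m) i U = E" if "i \<in> {1..n}" for i
      using local_residual_carrier[of Y i] E U(2)[OF that] by auto
    \<comment> \<open>There are \<open>n\<close> equal terms, each \<open>1 / n^2\<close> times the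
      full squared residual, which leaves the factor \<open>1 / n\<close>.\<close>
    then have "objective (X, Y, Z, U, W) = n * (frob_norm E)\<^sup>2"
      by (simp add: objective_eq)
    also have "(frob_norm E)\<^sup>2 = (1 / n)\<^sup>2 * (frob_norm (A * X * B - F))\<^sup>2"
    proof -
      have D: "A * X * B - F \<in> carrier_mat m q" using F by auto
      have "(E $$ (s, t))\<^sup>2 = (1 / n)\<^sup>2 * ((A * X * B - F) $$ (s, t))\<^sup>2" if "s < m" "t < q" for s t
        using F that by (simp add: E_def power_divide)
      then show ?thesis
        by (simp add: frob_norm_sq[OF E] frob_norm_sq[OF D] sum_distrib_left)
    qed
    finally show ?thesis
      using nonempty by (simp add: power2_eq_square)
  qed
  ultimately show ?thesis by blast
qed

text \<open>Partial minimization: for fixed \<open>X\<close> the least feasible objective value is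
  \<open>1 / n\<close> times the least squares objective, and it is attained.\<close>

lemma least_squares_solution_iff:
  assumes X: "X \<in> carrier_mat r p"
  shows "least_squares_solution A B F X \<longleftrightarrow>
    (\<exists>Y Z U W. is_arg_min objective feasible (X, Y, Z, U, W))"
proof
  have ls: "least_squares_solution A B F X \<longleftrightarrow> (\<forall>X' \<in> carrier_mat r p.
      (frob_norm (A * X * B - F))\<^sup>2 \<le> (frob_norm (A * X' * B - F))\<^sup>2)"
    using X A B by (auto simp: least_squares_solution_def is_arg_min_def not_less)
  {
    assume opt: "least_squares_solution A B F X"
    obtain Y Z U W where feas: "feasible (X, Y, Z, U, W)"
      and eq: "objective (X, Y, Z, U, W) = (frob_norm (A * X * B - F))\<^sup>2 / n"
      using ex_feasible_objective_eq[OF X] by blast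
    have "objective (X, Y, Z, U, W) \<le> objective (X', Y', Z', U', W')"
      if feas': "feasible (X', Y', Z', U', W')" for X' Y' Z' U' W'
    proof -
      have "objective (X, Y, Z, U, W) \<le> (frob_norm (A * X' * B - F))\<^sup>2 / n"
        using opt feas' unfolding eq ls by (intro divide_right_mono) (auto simp: feasible_iff)
      also have "\<dots> \<le> objective (X', Y', Z', U', W')"
        by (rule feasible_objective_ge[OF feas'])
      finally show ?thesis .
    qed
    then show "\<exists>Y Z U W. is_arg_min objective feasible (X, Y, Z, U, W)"
      using feas by (force simp: is_arg_min_def not_less)
  next
    assume "\<exists>Y Z U W. is_arg_min objective feasible (X, Y, Z, U, W)"
    then obtain Y Z U W where feas: "feasible (X, Y, Z, U, W)"
      and opt: "\<And>S. feasible S \<Longrightarrow> objective (X, Y, Z, U, W) \<le> objective S"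
      by (auto simp: is_arg_min_def not_less)
    show "least_squares_solution A B F X"
      unfolding ls
    proof
      fix X' :: "real mat" assume "X' \<in> carrier_mat r p"
      then obtain Y' Z' U' W' where "feasible (X', Y', Z', U', W')"
        and "objective (X', Y', Z', U', W') = (frob_norm (A * X' * B - F))\<^sup>2 / n"
        using ex_feasible_objective_eq by blast
      \<comment> \<open>The chain runs from the lower bound at \<open>X\<close>, through optimality,
        to the attained bound at \<open>X'\<close>.\<close>
      then have "(frob_norm (A * X * B - F))\<^sup>2 / n \<le> (frob_norm (A * X' * B - F))\<^sup>2 / n"
        using feasible_objective_ge[OF feas] opt by fastforce
      then show "(frob_norm (A * X * B - F))\<^sup>2 \<le> (frob_norm (A * X' * B - F))\<^sup>2"
        using nonempty by (simp add: divide_le_cancel)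
    qed
  }
qed

end

theorem mainTheorem8:
  fixes n m r p q :: nat
    and ms rs ps :: "nat \<Rightarrow> nat"
    and A B F X :: "real mat"
    and G :: "nat pair_pre_digraph"
    and a :: "nat \<Rightarrow> nat \<Rightarrow> real"
  assumes "m = (\<Sum>i = 1..n. ms i)" and "r = (\<Sum>i = 1..n. rs i)" and "p = (\<Sum>i = 1..n. ps i)"
    and "A \<in> carrier_mat m r" and "B \<in> carrier_mat p q" and "F \<in> carrier_mat m q"
    and "pair_pseudo_graph G" and "pverts G = {1..n}"
    and "weighted_adjacency G a"
    and "Digraph_Component.connected (with_proj G)"
    and "X \<in> carrier_mat r p"
  shows "least_squares_solution A B F X \<longleftrightarrow>
    (\<exists>Y \<in> carrier_mat r q. \<exists>Z \<in> carrier_mat (n * r) q.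
     \<exists>U \<in> carrier_mat (n * m) q. \<exists>W \<in> carrier_mat (n * m) q.
       is_arg_min (crr_objective n ms rs A F) (crr_feasible n a ms rs ps q B) (X, Y, Z, U, W))"
proof -
  interpret connected_weights n a
    using assms(7-10) by (rule connected_weightsI)
  interpret crr_problem n a m r p q ms rs ps A B F
    using assms(1-6) by unfold_locales
  show ?thesis
    \<comment> \<open>Feasibility contains the dimension conditions, so bounded and unbounded
      quantifiers over \<open>Y\<close>, \<open>Z\<close>, \<open>U\<close>, \<open>W\<close>
      agree.\<close>
    unfolding least_squares_solution_iff[OF assms(11)]
    by (auto simp: is_arg_min_def feasible_iff)
qed

end
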